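(* Assume $|\mathcal{A}|\geq 2$. Let $R$ be a congruence over closed $\mathrm{BCCSP}_{\|}$ terms such that ${\sim_{\mathtt{B}}}\subseteq R\subseteq {\sim_{\mathtt{PF}}}$. Then $R$ has no finite, ground-complete, equational axiomatisation over $\mathrm{BCCSP}_{\|}$, i.e. there is no finite set $\mathcal{E}$ of equations that is sound modulo $R$ and such that $p\,R\,q$ implies $\mathcal{E}\vdash p\approx q$ for all closed $p,q$.
   Context: Let $\mathcal{A}$ be a finite non-empty set of actions and $\mathcal{V}$ a countably infinite set of variables. $\mathrm{BCCSP}_{\|}$ terms: $t ::= \mathbf{0} \mid x \mid a.t \mid t+t \mid t \,\|\, t$ ($a\in\mathcal{A}$, $x\in\mathcal{V}$). Closed terms are processes. Transitions: $a.p \xrightarrow{a} p$; if $p \xrightarrow{a} p'$ then $p+q \xrightarrow{a} p'$, $q+p \xrightarrow{a} p'$, $p\|q \xrightarrow{a} p'\|q$, $q \| p \xrightarrow{a} q \| p'$. A simulation is a relation $S$ on processes such that $pSq$ and $p\xrightarrow{a}p'$ imply $q\xrightarrow{a}q'$ with $p'Sq'$ for some $q'$; bisimilarity $\sim_{\mathtt{B}}$ is the largest symmetric simulation. For $\alpha\in\mathcal{A}^*$, $p\xrightarrow{\alpha}p'$ denotes a path labelled $\alpha$; $\mathtt{T}(p)$ is the set of such $\alpha$ for some $p'$. A possible future of $p$ is $(\alpha,\mathtt{T}(p'))$ with $p\xrightarrow{\alpha}p'$; $p\sim_{\mathtt{PF}}q$ iff $p,q$ have the same possible futures. A congruence is an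 equivalence relation on processes preserved by $a.\_$, $+$ and $\|$. $\mathcal{E}\vdash t\approx u$: derivable in equational logic (reflexivity, symmetry, transitivity, substitution instances of equations of $\mathcal{E}$, closure under $a.\_$, $+$, $\|$). An equation $t\approx u$ is sound modulo $R$ if $\sigma(t)R\sigma(u)$ for every closed substitution $\sigma$. *)

theory Defs
  imports "HOL-Library.Countable_Set"
begin

text \<open>The type \<open>'a\<close> is the set of actions, \<open>'v\<close> the set of variables. The finiteness and
  cardinality requirements on them are hypotheses of the theorem.\<close>

datatype ('a, vars: 'v) trm =
    Nil  (\<open>\<zero>\<close>)
  | Var 'v
  | Prefix 'a "('a, 'v) trm"  (infixr \<open>\<cdot>\<close> 75)
  | Plus "('a, 'v) trm" "('a, 'v) trm"  (infixl \<open>\<oplus>\<close> 65)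
  | Par "('a, 'v) trm" "('a, 'v) trm"  (infixl \<open>\<parallel>\<close> 70)

hide_const (open) trm.Nil

definition processes :: "('a, 'v) trm set" where
  "processes = {t. vars t = {}}"

text \<open>Transitions are given by the rules on all terms, where a variable has no transition;
  they are only ever used on processes, which are closed under them (see \<open>step_processes\<close>).\<close>

inductive step :: "('a, 'v) trm \<Rightarrow> 'a \<Rightarrow> ('a, 'v) trm \<Rightarrow> bool" where
  prefix: "step (a \<cdot> p) a p"
| plus_left: "step p a p' \<Longrightarrow> step (p \<oplus> q) a p'"
| plus_right: "step p a p' \<Longrightarrow> step (q \<oplus> p) a p'"
| par_left: "step p a p' \<Longrightarrow> step (p \<parallel> q) a (p' \<parallel> q)"
| par_right: "step p a p' \<Longrightarrow> step (q \<parallel> p) a (q \<parallel> p')"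

lemma step_processes: "step p a p' \<Longrightarrow> p \<in> processes \<Longrightarrow> p' \<in> processes"
  by (induction rule: step.induct) (auto simp: processes_def)

inductive steps :: "('a, 'v) trm \<Rightarrow> 'a list \<Rightarrow> ('a, 'v) trm \<Rightarrow> bool" where
  refl: "steps p [] p"
| step: "step p a p' \<Longrightarrow> steps p' \<alpha> p'' \<Longrightarrow> steps p (a # \<alpha>) p''"

definition simulation :: "('a, 'v) trm rel \<Rightarrow> bool" where
  "simulation S \<longleftrightarrow> S \<subseteq> processes \<times> processes \<and>
     (\<forall>p q a p'. (p, q) \<in> S \<longrightarrow> step p a p' \<longrightarrow> (\<exists>q'. step q a q' \<and> (p', q') \<in> S))"

definition bisimilarity :: "('a, 'v) trm rel" where
  "bisimilarity = \<Union>{S. simulation S \<and> sym S}"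

lemma simulation_bisimilarity: "simulation bisimilarity"
  unfolding bisimilarity_def simulation_def by blast

lemma sym_bisimilarity: "sym bisimilarity"
  unfolding bisimilarity_def sym_def by blast

lemma bisimilarity_greatest: "simulation S \<Longrightarrow> sym S \<Longrightarrow> S \<subseteq> bisimilarity"
  unfolding bisimilarity_def by blast

definition traces :: "('a, 'v) trm \<Rightarrow> 'a list set" where
  "traces p = {\<alpha>. \<exists>p'. steps p \<alpha> p'}"

definition possible_futures :: "('a, 'v) trm \<Rightarrow> ('a list \<times> 'a list set) set" where
  "possible_futures p = {(\<alpha>, traces p') | \<alpha> p'. steps p \<alpha> p'}"

definition pf_equivalence :: "('a, 'v) trm rel" where
  "pf_equivalence =
     {(p, q). p \<in> processes \<and> q \<in> processes \<and> possible_futures p = possible_futures q}"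

definition congruence :: "('a, 'v) trm rel \<Rightarrow> bool" where
  "congruence R \<longleftrightarrow> equiv processes R \<and>
     (\<forall>a p q. (p, q) \<in> R \<longrightarrow> (a \<cdot> p, a \<cdot> q) \<in> R) \<and>
     (\<forall>p q p' q'. (p, q) \<in> R \<longrightarrow> (p', q') \<in> R \<longrightarrow> (p \<oplus> p', q \<oplus> q') \<in> R) \<and>
     (\<forall>p q p' q'. (p, q) \<in> R \<longrightarrow> (p', q') \<in> R \<longrightarrow> (p \<parallel> p', q \<parallel> q') \<in> R)"

primrec subst :: "('v \<Rightarrow> ('a, 'v) trm) \<Rightarrow> ('a, 'v) trm \<Rightarrow> ('a, 'v) trm" where
  "subst \<sigma> \<zero> = \<zero>"
| "subst \<sigma> (Var x) = \<sigma> x"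
| "subst \<sigma> (a \<cdot> t) = a \<cdot> subst \<sigma> t"
| "subst \<sigma> (t \<oplus> u) = subst \<sigma> t \<oplus> subst \<sigma> u"
| "subst \<sigma> (t \<parallel> u) = subst \<sigma> t \<parallel> subst \<sigma> u"

text \<open>An equation \<open>t \<approx> u\<close> is the pair \<open>(t, u)\<close>.\<close>

inductive derivable :: "('a, 'v) trm rel \<Rightarrow> ('a, 'v) trm \<Rightarrow> ('a, 'v) trm \<Rightarrow> bool"
  (\<open>_ \<turnstile> _ \<approx> _\<close> [51, 51, 51] 50) for E where
  refl: "E \<turnstile> t \<approx> t"
| sym: "E \<turnstile> t \<approx> u \<Longrightarrow> E \<turnstile> u \<approx> t"
| trans: "E \<turnstile> t \<approx> u \<Longrightarrow> E \<turnstile> u \<approx> v \<Longrightarrow> E \<turnstile> t \<approx> v"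
| axiom_inst: "(t, u) \<in> E \<Longrightarrow> E \<turnstile> subst \<sigma> t \<approx> subst \<sigma> u"
| prefix: "E \<turnstile> t \<approx> u \<Longrightarrow> E \<turnstile> a \<cdot> t \<approx> a \<cdot> u"
| plus: "E \<turnstile> t \<approx> u \<Longrightarrow> E \<turnstile> t' \<approx> u' \<Longrightarrow> E \<turnstile> t \<oplus> t' \<approx> u \<oplus> u'"
| par: "E \<turnstile> t \<approx> u \<Longrightarrow> E \<turnstile> t' \<approx> u' \<Longrightarrow> E \<turnstile> t \<parallel> t' \<approx> u \<parallel> u'"

definition sound_modulo :: "('a, 'v) trm rel \<Rightarrow> ('a, 'v) trm rel \<Rightarrow> bool" where
  "sound_modulo R E \<longleftrightarrow>
     (\<forall>(t, u) \<in> E. \<forall>\<sigma>. (\<forall>x. \<sigma> x \<in> processes) \<longrightarrow> (subst \<sigma> t, subst \<sigma> u) \<in> R)"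

definition ground_complete :: "('a, 'v) trm rel \<Rightarrow> ('a, 'v) trm rel \<Rightarrow> bool" where
  "ground_complete R E \<longleftrightarrow>
     (\<forall>p \<in> processes. \<forall>q \<in> processes. (p, q) \<in> R \<longrightarrow> E \<turnstile> p \<approx> q)"

end

theory Submission
  imports Defs "HOL-Library.Sublist"
begin

text \<open>For actions \<open>a \<noteq> b\<close> consider \<open>a \<parallel> p\<^sub>n\<close> with \<open>p\<^sub>n = \<Sum>\<^sub>1\<^sub>\<le>\<^sub>i\<^sub>\<le>\<^sub>n b a\<^sup>i b\<close>, which is bisimilar to a sum
  of prefixes. No equation between small terms can remove its parallel composition. Indeed, if an
  instance \<open>\<sigma>(t)\<close> has possible futures among those of \<open>a \<parallel> p\<^sub>n\<close> and a summand that is a parallel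
  composition of two active processes, then one of these has the traces of \<open>a\<close> and the other,
  \<open>\<sigma>(t'')\<close>, those of \<open>p\<^sub>n\<close>. The words \<open>a\<^sup>i b\<close> lie in pairwise different derivatives of \<open>\<sigma>(t'')\<close>,
  so if \<open>t\<close> has fewer than \<open>n\<close> subterms, some variable \<open>x\<close> of \<open>t''\<close> must contribute one of them.
  Replacing \<open>\<sigma>(x)\<close> by \<open>a b b\<close> gives \<open>t\<close> an \<open>a\<close>-derivative which the other side of a sound equation
  can match only if it also has such a parallel summand.\<close>

no_notation Sublist.parallel (infixl \<open>\<parallel>\<close> 50)

section \<open>Trace sets of processes and of their derivatives\<close>

text \<open>The possible futures whose word has length one. Possible-futures equivalence enters the
  argument through these sets.\<close>

definition der :: "('a, 'v) trm \<Rightarrow> 'a \<Rightarrow> 'a list set set" where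
  "der p c = traces ` {r. step p c r}"

definition shuffle_sets :: "'a list set \<Rightarrow> 'a list set \<Rightarrow> 'a list set" where
  "shuffle_sets X Y = (\<Union>\<alpha>\<in>X. \<Union>\<beta>\<in>Y. shuffles \<alpha> \<beta>)"

definition null :: "('a, 'v) trm \<Rightarrow> bool" where
  "null p \<longleftrightarrow> (\<forall>c r. \<not> step p c r)"

lemma step_simps [simp]:
  "\<not> step \<zero> c r"
  "\<not> step (Var x) c r"
  "step (d \<cdot> p) c r \<longleftrightarrow> c = d \<and> r = p"
  "step (p \<oplus> q) c r \<longleftrightarrow> step p c r \<or> step q c r"
  "step (p \<parallel> q) c r \<longleftrightarrow>
     (\<exists>p'. step p c p' \<and> r = p' \<parallel> q) \<or> (\<exists>q'. step q c q' \<and> r = p \<parallel> q')"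
  by (auto elim: step.cases intro: step.intros)

lemma null_simps [simp]:
  "null \<zero>"
  "\<not> null (c \<cdot> p)"
  "null (p \<oplus> q) \<longleftrightarrow> null p \<and> null q"
  "null (p \<parallel> q) \<longleftrightarrow> null p \<and> null q"
  by (auto simp: null_def)

lemma Nil_in_traces [simp]: "[] \<in> traces p"
  by (auto simp: traces_def intro: steps.refl)

lemma Cons_in_traces: "c # \<alpha> \<in> traces p \<longleftrightarrow> (\<exists>r. step p c r \<and> \<alpha> \<in> traces r)"
proof -
  have "steps p (c # \<alpha>) q \<longleftrightarrow> (\<exists>r. step p c r \<and> steps r \<alpha> q)" for q
    by (subst steps.simps) auto
  then show ?thesis unfolding traces_def by blast
qed

lemma Cons_in_traces_der: "c # \<alpha> \<in> traces p \<longleftrightarrow> (\<exists>X \<in> der p c. \<alpha> \<in> X)"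
  by (auto simp: Cons_in_traces der_def)

lemma traces_mono_der: "(\<And>c. der p c \<subseteq> der q c) \<Longrightarrow> traces p \<subseteq> traces q"
proof
  fix \<alpha> assume "\<And>c. der p c \<subseteq> der q c" "\<alpha> \<in> traces p"
  then show "\<alpha> \<in> traces q"
    by (cases \<alpha>) (auto simp: Cons_in_traces_der)
qed

lemma traces_append: "\<alpha> @ \<beta> \<in> traces p \<Longrightarrow> \<alpha> \<in> traces p"
  by (induction \<alpha> arbitrary: p) (auto simp: Cons_in_traces)

lemma Cons_in_traces_prefix [simp]: "c # \<alpha> \<in> traces (d \<cdot> p) \<longleftrightarrow> c = d \<and> \<alpha> \<in> traces p"
  by (auto simp: Cons_in_traces)

lemma Cons_in_traces_Nil [simp]: "c # \<alpha> \<notin> traces \<zero>"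
  by (auto simp: Cons_in_traces)

lemma null_traces: "null p \<longleftrightarrow> traces p = {[]}"
proof
  assume "null p"
  then have "\<alpha> \<in> traces p \<Longrightarrow> \<alpha> = []" for \<alpha>
    by (cases \<alpha>) (auto simp: null_def Cons_in_traces)
  then show "traces p = {[]}" by auto
next
  assume T: "traces p = {[]}"
  have "\<not> step p c r" for c r
  proof
    assume "step p c r"
    then have "[c] \<in> traces p" by (auto simp: Cons_in_traces)
    with T show False by simp
  qed
  then show "null p" by (simp add: null_def)
qed

lemma traces_Nil [simp]: "traces \<zero> = {[]}"
  using null_traces[of \<zero>] by simp

lemma not_null_iff: "\<not> null p \<longleftrightarrow> (\<exists>c. [c] \<in> traces p)"
  by (auto simp: null_def Cons_in_traces)

lemma traces_plus [simp]: "traces (p \<oplus> q) = traces p \<union> traces q"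
proof (rule set_eqI)
  show "\<alpha> \<in> traces (p \<oplus> q) \<longleftrightarrow> \<alpha> \<in> traces p \<union> traces q" for \<alpha>
    by (cases \<alpha>) (auto simp: Cons_in_traces)
qed

lemma Cons_in_shuffles:
  "c # \<gamma> \<in> shuffles \<alpha> \<beta> \<longleftrightarrow>
     (\<exists>\<alpha>'. \<alpha> = c # \<alpha>' \<and> \<gamma> \<in> shuffles \<alpha>' \<beta>) \<or> (\<exists>\<beta>'. \<beta> = c # \<beta>' \<and> \<gamma> \<in> shuffles \<alpha> \<beta>')"
  by (cases \<alpha>; cases \<beta>) (auto simp: Cons_in_shuffles_iff)

text \<open>The first letter of an interleaving comes from one of the two words, just as the first
  step of \<open>p \<parallel> q\<close> comes from one of the two factors.\<close>

lemma in_traces_par: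
  "\<gamma> \<in> traces (p \<parallel> q) \<longleftrightarrow> (\<exists>\<alpha> \<in> traces p. \<exists>\<beta> \<in> traces q. \<gamma> \<in> shuffles \<alpha> \<beta>)"
proof (induction \<gamma> arbitrary: p q)
  case Nil
  then show ?case by auto
next
  case (Cons c \<gamma>)
  have "c # \<gamma> \<in> traces (p \<parallel> q) \<longleftrightarrow>
      (\<exists>p'. step p c p' \<and> \<gamma> \<in> traces (p' \<parallel> q)) \<or> (\<exists>q'. step q c q' \<and> \<gamma> \<in> traces (p \<parallel> q'))"
    by (auto simp: Cons_in_traces)
  also have "\<dots> \<longleftrightarrow>
      (\<exists>\<alpha> \<beta>. c # \<alpha> \<in> traces p \<and> \<beta> \<in> traces q \<and> \<gamma> \<in> shuffles \<alpha> \<beta>) \<or>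
      (\<exists>\<alpha> \<beta>. \<alpha> \<in> traces p \<and> c # \<beta> \<in> traces q \<and> \<gamma> \<in> shuffles \<alpha> \<beta>)"
    unfolding Cons.IH Cons_in_traces by blast
  also have "\<dots> \<longleftrightarrow> (\<exists>\<alpha> \<in> traces p. \<exists>\<beta> \<in> traces q. c # \<gamma> \<in> shuffles \<alpha> \<beta>)"
    unfolding Cons_in_shuffles by blast
  finally show ?case .
qed

lemma traces_par: "traces (p \<parallel> q) = shuffle_sets (traces p) (traces q)"
  by (rule set_eqI) (simp only: in_traces_par shuffle_sets_def UN_iff)

lemma shuffle_sets_commute: "shuffle_sets X Y = shuffle_sets Y X"
  unfolding shuffle_sets_def by (subst SUP_commute) (simp only: shuffles_commutes)

lemma shuffle_sets_Nil [simp]: "shuffle_sets X {[]} = X" "shuffle_sets {[]} X = X"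
  by (auto simp: shuffle_sets_def)

lemma append_in_shuffle_sets: "\<alpha> \<in> X \<Longrightarrow> \<beta> \<in> Y \<Longrightarrow> \<alpha> @ \<beta> \<in> shuffle_sets X Y"
proof -
  have "\<alpha> @ \<beta> \<in> shuffles \<alpha> \<beta>"
    by (induction \<alpha>) (auto simp: Cons_in_shuffles_iff)
  then show "\<alpha> \<in> X \<Longrightarrow> \<beta> \<in> Y \<Longrightarrow> \<alpha> @ \<beta> \<in> shuffle_sets X Y"
    by (auto simp: shuffle_sets_def)
qed

lemma der_simps [simp]:
  "der \<zero> c = {}"
  "der (d \<cdot> p) c = (if c = d then {traces p} else {})"
  "der (p \<oplus> q) c = der p c \<union> der q c"
  by (auto simp: der_def)

lemma der_par:
  "der (p \<parallel> q) c =
     (\<lambda>X. shuffle_sets X (traces q)) ` der p c \<union> shuffle_sets (traces p) ` der q c"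
proof -
  have "{r. step (p \<parallel> q) c r} = (\<lambda>p'. p' \<parallel> q) ` {r. step p c r} \<union> (\<lambda>q'. p \<parallel> q') ` {r. step q c r}"
    by auto
  then show ?thesis by (simp add: der_def image_Un image_image traces_par)
qed

lemma der_par_commute:
  fixes p q :: "('a, 'v) trm"
  shows "der (p \<parallel> q) c = der (q \<parallel> p) c"
proof -
  have eq: "(\<lambda>X. shuffle_sets X Y) = shuffle_sets Y" for Y :: "'a list set"
    by (rule ext) (rule shuffle_sets_commute)
  show ?thesis unfolding der_par eq by (rule Un_commute)
qed

lemma null_der: "null p \<Longrightarrow> der p c = {}"
  by (auto simp: null_def der_def)

lemma der_par_null [simp]:
  "null q \<Longrightarrow> der (p \<parallel> q) c = der p c" "null q \<Longrightarrow> der (q \<parallel> p) c = der p c"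
  by (simp_all add: der_par null_der null_traces[THEN iffD1])

lemma possible_futures_der: "der p c = {X. ([c], X) \<in> possible_futures p}"
  by (force simp: der_def possible_futures_def intro: steps.intros elim: steps.cases)

section \<open>Substitution instances and their summands\<close>

lemma closed_subst:
  "(\<And>x. \<sigma> x \<in> processes) \<Longrightarrow> subst \<sigma> t \<in> processes"
  by (induction t) (auto simp: processes_def)

lemma subst_closed: "p \<in> processes \<Longrightarrow> subst \<sigma> p = p"
  by (induction p) (auto simp: processes_def)

lemma subst_subst: "subst \<rho> (subst \<sigma> t) = subst (\<lambda>x. subst \<rho> (\<sigma> x)) t"
  by (induction t) auto

lemma subst_cong: "(\<And>x. x \<in> vars t \<Longrightarrow> \<sigma> x = \<tau> x) \<Longrightarrow> subst \<sigma> t = subst \<tau> t"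
  by (induction t) auto

lemma null_subst_cong: "(\<And>x. null (\<sigma> x) \<longleftrightarrow> null (\<tau> x)) \<Longrightarrow> null (subst \<sigma> t) \<longleftrightarrow> null (subst \<tau> t)"
  by (induction t) auto

text \<open>Nothing ever blocks an occurrence of a variable, so what it does is eventually visible.\<close>

lemma traces_of_occurrence:
  "x \<in> vars t \<Longrightarrow> \<beta> \<in> traces (\<sigma> x) \<Longrightarrow> \<exists>\<alpha>. \<alpha> @ \<beta> \<in> traces (subst \<sigma> t)"
proof (induction t)
  case (Var y)
  then show ?case by (auto intro: exI[of _ "[]"])
next
  case (Prefix c t)
  then obtain \<alpha> where "\<alpha> @ \<beta> \<in> traces (subst \<sigma> t)" by auto
  then show ?case by (auto intro: exI[of _ "c # \<alpha>"])
next
  case (Par t u)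
  then obtain \<alpha> where "\<alpha> @ \<beta> \<in> traces (subst \<sigma> t) \<or> \<alpha> @ \<beta> \<in> traces (subst \<sigma> u)" by auto
  then show ?case
    using append_in_shuffle_sets[of "\<alpha> @ \<beta>" "traces (subst \<sigma> t)" "[]" "traces (subst \<sigma> u)"]
      append_in_shuffle_sets[of "[]" "traces (subst \<sigma> t)" "\<alpha> @ \<beta>" "traces (subst \<sigma> u)"]
    by (auto simp: traces_par)
qed auto

primrec subterms :: "('a, 'v) trm \<Rightarrow> ('a, 'v) trm set" where
  "subterms \<zero> = {\<zero>}"
| "subterms (Var x) = {Var x}"
| "subterms (c \<cdot> t) = insert (c \<cdot> t) (subterms t)"
| "subterms (t \<oplus> u) = insert (t \<oplus> u) (subterms t \<union> subterms u)"
| "subterms (t \<parallel> u) = insert (t \<parallel> u) (subterms t \<union> subterms u)"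

lemma finite_subterms [simp]: "finite (subterms t)"
  by (induction t) auto

lemma subterms_trans: "s \<in> subterms t \<Longrightarrow> r \<in> subterms s \<Longrightarrow> r \<in> subterms t"
  by (induction t) auto

text \<open>Summands, where a parallel factor that becomes inert under \<open>\<sigma>\<close> is disregarded.\<close>

inductive head :: "('v \<Rightarrow> ('a, 'v) trm) \<Rightarrow> ('a, 'v) trm \<Rightarrow> ('a, 'v) trm \<Rightarrow> bool" for \<sigma> where
  refl: "head \<sigma> t t"
| plus_left: "head \<sigma> s t \<Longrightarrow> head \<sigma> s (t \<oplus> u)"
| plus_right: "head \<sigma> s u \<Longrightarrow> head \<sigma> s (t \<oplus> u)"
| par_left: "head \<sigma> s t \<Longrightarrow> null (subst \<sigma> u) \<Longrightarrow> head \<sigma> s (t \<parallel> u)"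
| par_right: "head \<sigma> s u \<Longrightarrow> null (subst \<sigma> t) \<Longrightarrow> head \<sigma> s (t \<parallel> u)"

lemma head_subterms: "head \<sigma> s t \<Longrightarrow> s \<in> subterms t"
proof (induction rule: head.induct)
  case (refl t)
  then show ?case by (cases t) auto
qed auto

lemma head_der: "head \<sigma> s t \<Longrightarrow> der (subst \<sigma> s) c \<subseteq> der (subst \<sigma> t) c"
  by (induction rule: head.induct) auto

text \<open>Exchanging one active value of a variable for another keeps inert factors inert. Heads
  found under \<open>\<sigma>\<close> thus survive the passage to
  \<open>\<sigma>(x := q)\<close>.\<close>

lemma head_cong:
  assumes "head \<sigma> s t" "\<And>x. null (\<sigma> x) \<longleftrightarrow> null (\<tau> x)"
  shows "head \<tau> s t"
  using assms(1)
  by (induction rule: head.induct)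
    (auto intro: head.intros simp: null_subst_cong[of \<sigma> \<tau>, OF assms(2)])

text \<open>The last case says nothing about \<open>X\<close>: wherever the lemma is applied, an
  active parallel summand is contradictory in itself.\<close>

lemma der_subst_cases:
  assumes "X \<in> der (subst \<sigma> t) c"
  obtains (Var) x where "head \<sigma> (Var x) t" "X \<in> der (\<sigma> x) c"
  | (Prefix) w where "head \<sigma> (c \<cdot> w) t" "X = traces (subst \<sigma> w)"
  | (Par) t1 t2 where "head \<sigma> (t1 \<parallel> t2) t" "\<not> null (subst \<sigma> t1)" "\<not> null (subst \<sigma> t2)"
proof -
  have "(\<exists>x. head \<sigma> (Var x) t \<and> X \<in> der (\<sigma> x) c) \<or>
        (\<exists>w. head \<sigma> (c \<cdot> w) t \<and> X = traces (subst \<sigma> w)) \<or>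
        (\<exists>t1 t2. head \<sigma> (t1 \<parallel> t2) t \<and> \<not> null (subst \<sigma> t1) \<and> \<not> null (subst \<sigma> t2))"
    using assms
  proof (induction t)
    case (Plus t u)
    then consider "X \<in> der (subst \<sigma> t) c" | "X \<in> der (subst \<sigma> u) c" by auto
    then show ?case
    proof cases
      case 1
      from Plus.IH(1)[OF this] show ?thesis by (blast intro: head.plus_left)
    next
      case 2
      from Plus.IH(2)[OF this] show ?thesis by (blast intro: head.plus_right)
    qed
  next
    case (Par t u)
    consider "null (subst \<sigma> t)" | "null (subst \<sigma> u)"
      | "\<not> null (subst \<sigma> t)" "\<not> null (subst \<sigma> u)" by blast
    then show ?case
    proof cases
      case 1
      then have "X \<in> der (subst \<sigma> u) c" using Par.prems by simp
      from Par.IH(2)[OF this] 1 show ?thesis by (blast intro: head.par_right)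
    next
      case 2
      then have "X \<in> der (subst \<sigma> t) c" using Par.prems by simp
      from Par.IH(1)[OF this] 2 show ?thesis by (blast intro: head.par_left)
    qed (blast intro: head.refl)
  qed (auto intro: head.intros split: if_splits)
  then show ?thesis using that by blast
qed

section \<open>Active parallel summands\<close>

text \<open>The invariant of derivations from small equations. It is syntactic and not respected by
  bisimilarity: for \<open>n \<ge> 1\<close>, \<open>lhs n\<close> has it and \<open>rhs n\<close>
  does not.\<close>

primrec has_par_summand :: "('a, 'v) trm \<Rightarrow> bool" where
  "has_par_summand \<zero> = False"
| "has_par_summand (Var x) = False"
| "has_par_summand (c \<cdot> p) = False"
| "has_par_summand (p \<oplus> q) \<longleftrightarrow> has_par_summand p \<or> has_par_summand q"
| "has_par_summand (p \<parallel> q) \<longleftrightarrow>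
     (if null q then has_par_summand p else if null p then has_par_summand q else True)"

lemma null_no_par_summand: "null p \<Longrightarrow> \<not> has_par_summand p"
  by (induction p) auto

lemma head_has_par_summand:
  "head \<sigma> s t \<Longrightarrow> has_par_summand (subst \<sigma> s) \<Longrightarrow> has_par_summand (subst \<sigma> t)"
  by (induction rule: head.induct) (auto dest: null_no_par_summand)

text \<open>The parallel operator is either hidden in the value of a variable or displayed in
  \<open>t\<close>; the two cases need different arguments later.\<close>

lemma has_par_summand_cases:
  assumes "has_par_summand (subst \<sigma> t)"
  obtains (Var) x where "head \<sigma> (Var x) t" "has_par_summand (\<sigma> x)"
  | (Par) t1 t2 where "head \<sigma> (t1 \<parallel> t2) t" "\<not> null (subst \<sigma> t1)" "\<not> null (subst \<sigma> t2)"
proof -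
  have "(\<exists>x. head \<sigma> (Var x) t \<and> has_par_summand (\<sigma> x)) \<or>
        (\<exists>t1 t2. head \<sigma> (t1 \<parallel> t2) t \<and> \<not> null (subst \<sigma> t1) \<and> \<not> null (subst \<sigma> t2))"
    using assms
  proof (induction t)
    case (Plus t u)
    then consider "has_par_summand (subst \<sigma> t)" | "has_par_summand (subst \<sigma> u)" by auto
    then show ?case
    proof cases
      case 1
      from Plus.IH(1)[OF this] show ?thesis by (blast intro: head.plus_left)
    next
      case 2
      from Plus.IH(2)[OF this] show ?thesis by (blast intro: head.plus_right)
    qed
  next
    case (Par t u)
    consider "null (subst \<sigma> u)" | "null (subst \<sigma> t)" "\<not> null (subst \<sigma> u)"
      | "\<not> null (subst \<sigma> t)" "\<not> null (subst \<sigma> u)" by blast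
    then show ?case
    proof cases
      case 1
      then have "has_par_summand (subst \<sigma> t)" using Par.prems by simp
      from Par.IH(1)[OF this] 1 show ?thesis by (blast intro: head.par_left)
    next
      case 2
      then have "has_par_summand (subst \<sigma> u)" using Par.prems by simp
      from Par.IH(2)[OF this] 2 show ?thesis by (blast intro: head.par_right)
    qed (blast intro: head.refl)
  qed (auto intro: head.refl)
  then show ?thesis using that by blast
qed

lemma has_par_summandD:
  fixes p :: "('a, 'v) trm"
  assumes "has_par_summand p"
  obtains q1 q2 :: "('a, 'v) trm" where "\<forall>c. der (q1 \<parallel> q2) c \<subseteq> der p c" "\<not> null q1" "\<not> null q2"
proof -
  have "\<exists>q1 q2 :: ('a, 'v) trm. (\<forall>c. der (q1 \<parallel> q2) c \<subseteq> der p c) \<and> \<not> null q1 \<and> \<not> null q2"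
    using assms
  proof (induction p)
    case (Plus p q)
    then show ?case by simp blast
  next
    case (Par p q)
    show ?case
    proof (cases "null p \<or> null q")
      case True
      with Par show ?thesis by (auto split: if_splits dest: null_no_par_summand)
    next
      case False
      then show ?thesis by blast
    qed
  qed auto
  then show ?thesis using that by blast
qed

section \<open>Words and finite sums as processes\<close>

primrec word :: "'a list \<Rightarrow> ('a, 'v) trm" where
  "word [] = \<zero>"
| "word (c # w) = c \<cdot> word w"

lemma vars_word [simp]: "vars (word w) = {}"
  by (induction w) auto

lemma traces_word [simp]: "traces (word w :: ('a, 'v) trm) = set (prefixes w)"
proof -
  have "\<alpha> \<in> traces (word w :: ('a, 'v) trm) \<longleftrightarrow> prefix \<alpha> w" for \<alpha>
  proof (induction w arbitrary: \<alpha>)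
    case (Cons c w)
    then show ?case by (cases \<alpha>) auto
  qed simp
  then show ?thesis by (simp add: set_eq_iff)
qed

primrec sum_upto :: "(nat \<Rightarrow> ('a, 'v) trm) \<Rightarrow> nat \<Rightarrow> ('a, 'v) trm" where
  "sum_upto f 0 = \<zero>"
| "sum_upto f (Suc n) = sum_upto f n \<oplus> f (Suc n)"

lemma step_sum_upto: "step (sum_upto f n) c r \<longleftrightarrow> (\<exists>i \<in> {1..n}. step (f i) c r)"
  by (induction n) (auto simp: atLeastAtMostSuc_conv)

lemma traces_sum_upto: "traces (sum_upto f n) = insert [] (\<Union>i \<in> {1..n}. traces (f i))"
  by (induction n) (auto simp: atLeastAtMostSuc_conv)

lemma vars_sum_upto: "vars (sum_upto f n) = (\<Union>i \<in> {1..n}. vars (f i))"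
  by (induction n) (auto simp: atLeastAtMostSuc_conv)

lemma not_has_par_summand_sum_upto:
  "(\<And>i. \<not> has_par_summand (f i)) \<Longrightarrow> \<not> has_par_summand (sum_upto f n)"
  by (induction n) auto

section \<open>The processes \<open>a \<parallel> p\<^sub>n\<close> and their languages\<close>

context
  fixes a b :: 'a
  assumes ab: "a \<noteq> b"
begin

text \<open>The final \<open>b\<close> keeps one branch from being a prefix of another.\<close>

definition branch :: "nat \<Rightarrow> 'a list" where
  "branch i = replicate i a @ [b]"

definition p_sum :: "nat \<Rightarrow> ('a, 'v) trm" where
  "p_sum = sum_upto (\<lambda>i. b \<cdot> word (branch i))"

definition lhs :: "nat \<Rightarrow> ('a, 'v) trm" where
  "lhs n = a \<cdot> \<zero> \<parallel> p_sum n"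

text \<open>Keeping the inert factor makes the derivatives of both sides identical.\<close>

definition rhs :: "nat \<Rightarrow> ('a, 'v) trm" where
  "rhs n = a \<cdot> (\<zero> \<parallel> p_sum n) \<oplus> sum_upto (\<lambda>i. b \<cdot> (a \<cdot> \<zero> \<parallel> word (branch i))) n"

lemma lhs_processes: "lhs n \<in> processes"
  by (auto simp: lhs_def p_sum_def vars_sum_upto processes_def)

lemma rhs_processes: "rhs n \<in> processes"
  by (auto simp: rhs_def p_sum_def vars_sum_upto processes_def)

lemma step_lhs:
  "step (lhs n) c r \<longleftrightarrow>
     c = a \<and> r = \<zero> \<parallel> p_sum n \<or>
     c = b \<and> (\<exists>i \<in> {1..n}. r = a \<cdot> \<zero> \<parallel> word (branch i))"
  by (auto simp: lhs_def p_sum_def step_sum_upto)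

lemma step_rhs: "step (rhs n) c r \<longleftrightarrow> step (lhs n) c r"
  by (auto simp: step_lhs) (auto simp: rhs_def step_sum_upto)

lemma lhs_rhs_bisimilar: "(lhs n, rhs n) \<in> bisimilarity"
proof -
  \<comment> \<open>Both sides have literally the same transitions, so after one step the identity
    suffices.\<close>
  let ?S = "{(lhs n, rhs n), (rhs n, lhs n)} \<union> Id_on processes"
  have "simulation ?S"
    using lhs_processes rhs_processes step_processes
    by (auto simp: simulation_def step_rhs; fastforce)
  moreover have "sym ?S"
    by (auto simp: sym_def)
  ultimately show ?thesis using bisimilarity_greatest[of ?S] by blast
qed

lemma rhs_not_has_par_summand: "\<not> has_par_summand (rhs n)"
  by (auto simp: rhs_def not_has_par_summand_sum_upto)

text \<open>The traces of \<open>p_sum n\<close>, freed from the type of variables.\<close>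

definition p_lang :: "nat \<Rightarrow> 'a list set" where
  "p_lang n = {\<alpha>. \<alpha> = [] \<or> (\<exists>i \<in> {1..n}. prefix \<alpha> (b # branch i))}"

lemma traces_p_sum: "traces (p_sum n :: ('a, 'v) trm) = p_lang n"
proof -
  have eq: "(p_sum n :: ('a, 'v) trm) = sum_upto (\<lambda>i. word (b # branch i)) n" by (simp add: p_sum_def)
  show ?thesis unfolding eq traces_sum_upto traces_word p_lang_def by (auto simp del: prefixes.simps)
qed

lemma p_sum_Cons: "c # \<alpha> \<in> p_lang n \<Longrightarrow> c = b"
  by (auto simp: p_lang_def)

text \<open>Indices start at 1, so every branch begins with \<open>a\<close>.\<close>

lemma p_sum_bb: "b # b # \<alpha> \<notin> p_lang n"
proof
  assume "b # b # \<alpha> \<in> p_lang n"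
  then obtain i where "i \<ge> 1" "prefix (b # \<alpha>) (branch i)"
    by (auto simp: p_lang_def)
  then show False using ab by (cases i) (auto simp: branch_def)
qed

lemma p_sum_branch: "i \<in> {1..n} \<Longrightarrow> b # branch i \<in> p_lang n"
  by (auto simp: p_lang_def)

lemma lhs_has_par_summand:
  assumes "n \<ge> 1"
  shows "has_par_summand (lhs n)"
proof -
  have "b # branch 1 \<in> p_lang n" using assms by (simp add: p_sum_branch)
  then have "\<not> null (p_sum n)" by (auto simp: null_traces traces_p_sum)
  then show ?thesis by (simp add: lhs_def)
qed

text \<open>A nonempty \<open>\<alpha>\<close> would absorb the initial \<open>b\<close>, leaving
  two more occurrences of \<open>b\<close> for some \<open>branch j\<close>, which has only
  one.\<close>

lemma p_sum_unshifted:
  assumes "\<alpha> @ b # branch i \<in> p_lang n"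
  shows "\<alpha> = []"
proof -
  obtain j where "prefix (\<alpha> @ b # branch i) (b # branch j)"
    using assms by (auto simp: p_lang_def)
  then obtain \<gamma> where \<gamma>: "b # branch j = (\<alpha> @ b # branch i) @ \<gamma>"
    by (auto elim: prefixE)
  show ?thesis
  proof (cases \<alpha>)
    case (Cons c \<alpha>')
    with \<gamma> have "replicate j a @ [b] = \<alpha>' @ b # replicate i a @ b # \<gamma>"
      by (auto simp: branch_def)
    then have "filter ((=) b) (replicate j a @ [b]) = filter ((=) b) (\<alpha>' @ b # replicate i a @ b # \<gamma>)"
      by simp
    then have "length (filter ((=) b) (replicate j a @ [b])) \<ge> 2" by simp
    then show ?thesis using ab by (auto simp: filter_replicate)
  qed auto
qed

lemma traces_single: "traces (c \<cdot> \<zero>) = {[], [c]}"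
  using traces_word[of "[c]"] by simp

lemma der_lhs:
  "der (lhs n :: ('a, 'v) trm) a = {p_lang n}"
  "der (lhs n :: ('a, 'v) trm) b =
     (\<lambda>i. shuffle_sets {[], [a]} (set (prefixes (branch i)))) ` {1..n}"
proof -
  show "der (lhs n :: ('a, 'v) trm) a = {p_lang n}"
    using ab by (simp add: der_def step_lhs traces_par traces_p_sum)
  have "{r :: ('a, 'v) trm. step (lhs n) b r} = (\<lambda>i. a \<cdot> \<zero> \<parallel> word (branch i)) ` {1..n}"
    using ab by (auto simp: step_lhs)
  then show "der (lhs n :: ('a, 'v) trm) b =
      (\<lambda>i. shuffle_sets {[], [a]} (set (prefixes (branch i)))) ` {1..n}"
    by (simp add: der_def image_image traces_par traces_single)
qed

text \<open>The letter \<open>b\<close> can only come from \<open>branch k\<close>, which is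
  therefore used in full. The \<open>a\<close> after it must then use the other factor, and
  comparing lengths gives the claim.\<close>

lemma lhs_branch_unique:
  assumes "branch i @ [a] \<in> shuffle_sets {[], [a]} (set (prefixes (branch k)))"
  shows "i = k"
proof -
  obtain \<alpha> where "\<alpha> \<in> {[], [a]}"
    and "branch i @ [a] \<in> (\<Union>\<beta> \<in> set (prefixes (branch k)). shuffles \<alpha> \<beta>)"
    using assms unfolding shuffle_sets_def by (rule UN_E)
  then obtain \<beta> where \<alpha>: "\<alpha> = [] \<or> \<alpha> = [a]" and \<beta>: "prefix \<beta> (branch k)"
    and sh: "branch i @ [a] \<in> shuffles \<alpha> \<beta>"
    by auto
  have "set (branch i @ [a]) = set \<alpha> \<union> set \<beta>"
    using sh by (rule set_shuffles)
  moreover have "b \<notin> set \<alpha>" using \<alpha> ab by auto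
  ultimately have "b \<in> set \<beta>" by (auto simp: branch_def)
  have "\<beta> = branch k"
  proof (rule ccontr)
    assume "\<beta> \<noteq> branch k"
    with \<beta> have "prefix \<beta> (replicate k a)" by (auto simp: branch_def)
    then have "set \<beta> \<subseteq> set (replicate k a)" by (rule set_mono_prefix)
    with \<open>b \<in> set \<beta>\<close> ab show False by (auto split: if_splits)
  qed
  moreover have "\<alpha> \<noteq> []"
  proof
    assume "\<alpha> = []"
    with sh have "branch i @ [a] = branch k" using \<open>\<beta> = branch k\<close> by simp
    then have "last (branch i @ [a]) = last (branch k)" by simp
    with ab show False by (simp add: branch_def)
  qed
  ultimately show ?thesis
    using length_shuffles[OF sh] \<alpha> by (auto simp: branch_def)
qed

lemma lhs_pair:
  assumes "[c, d] \<in> traces (lhs n :: ('a, 'v) trm)"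
  shows "c = a \<and> d = b \<or> c = b \<and> d = a"
proof -
  obtain r :: "('a, 'v) trm" where r: "step (lhs n) c r" "[d] \<in> traces r"
    using assms by (auto simp: Cons_in_traces[of c])
  from r(1) consider "c = a" "r = \<zero> \<parallel> p_sum n"
    | i where "c = b" "i \<ge> 1" "r = a \<cdot> \<zero> \<parallel> word (branch i)"
    by (auto simp: step_lhs)
  then show ?thesis
  proof cases
    case 1
    then show ?thesis using r(2) p_sum_Cons by (auto simp: traces_par traces_p_sum)
  next
    case 2
    then obtain k where "i = Suc k" by (cases i) auto
    then have "branch i = a # branch k" by (simp add: branch_def)
    then show ?thesis using 2 r(2) by (auto simp: Cons_in_traces)
  qed
qed

section \<open>Processes whose derivatives are among those of \<open>lhs n\<close>\<close>

text \<open>An inclusion is inherited by the summands of a sum, as the induction over derivations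
  requires.\<close>

definition below :: "nat \<Rightarrow> ('a, 'v) trm \<Rightarrow> bool" where
  "below n p \<longleftrightarrow> (\<forall>c. der p c \<subseteq> der (lhs n :: ('a, 'v) trm) c)"

text \<open>A first action of one factor followed by one of the other is a trace of
  \<open>lhs n\<close>, hence one is \<open>a\<close> and the other \<open>b\<close>. This leaves
  each factor a single first action.\<close>

lemma below_par_cases:
  fixes p q :: "('a, 'v) trm"
  assumes "below n (p \<parallel> q)" "\<not> null p" "\<not> null q"
  obtains (left) "\<forall>c. [c] \<in> traces p \<longrightarrow> c = a" "\<forall>c. [c] \<in> traces q \<longrightarrow> c = b"
    | (right) "\<forall>c. [c] \<in> traces p \<longrightarrow> c = b" "\<forall>c. [c] \<in> traces q \<longrightarrow> c = a"
proof -
  obtain c d where cd: "[c] \<in> traces p" "[d] \<in> traces q"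
    using assms(2,3) by (auto simp: not_null_iff)
  have *: "c = a \<and> d = b \<or> c = b \<and> d = a" if "[c] \<in> traces p" "[d] \<in> traces q" for c d
  proof -
    have "[c, d] \<in> traces (p \<parallel> q)"
      using append_in_shuffle_sets[OF that] by (simp add: traces_par)
    moreover have "traces (p \<parallel> q) \<subseteq> traces (lhs n :: ('a, 'v) trm)"
      by (rule traces_mono_der) (use assms(1) in \<open>simp add: below_def\<close>)
    ultimately have "[c, d] \<in> traces (lhs n :: ('a, 'v) trm)" by blast
    then show ?thesis by (rule lhs_pair)
  qed
  from *[OF cd] show ?thesis
    using that *[OF cd(1)] *[OF _ cd(2)] ab by metis
qed

text \<open>Beside \<open>q\<close>, an \<open>a\<close>-derivative of \<open>p\<close> must have
  exactly the language \<open>p_lang n\<close>. If it could act, that action followed by the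
  \<open>b\<close> of \<open>q\<close> would be a word outside this language; so it is inert and
  \<open>q\<close> has the language alone. A \<open>b\<close>-derivative of \<open>q\<close>, run
  beside \<open>a\<close>, must match a single branch.\<close>

lemma below_par_left:
  fixes p q :: "('a, 'v) trm"
  assumes below: "below n (p \<parallel> q)" and "\<not> null p" "\<not> null q"
    and p: "\<forall>c. [c] \<in> traces p \<longrightarrow> c = a" and q: "\<forall>c. [c] \<in> traces q \<longrightarrow> c = b"
  shows "traces p = {[], [a]}" "traces q = p_lang n"
    and "\<forall>X \<in> der q b. \<forall>i j. branch i \<in> X \<longrightarrow> branch j \<in> X \<longrightarrow> i = j"
proof -
  have "[a] \<in> traces p" and bq: "[b] \<in> traces q"
    using assms by (auto simp: not_null_iff)
  have a_der: "X = {[]} \<and> traces q = p_lang n" if X: "X \<in> der p a" for X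
  proof -
    obtain r where "step p a r" and r: "X = traces r" using X by (auto simp: der_def)
    have "shuffle_sets X (traces q) \<in> der (lhs n :: ('a, 'v) trm) a"
      using below X by (auto simp: below_def der_par)
    then have sh: "shuffle_sets X (traces q) = p_lang n"
      by (simp add: der_lhs)
    have "null r"
    proof (rule ccontr)
      assume "\<not> null r"
      then obtain c where "[c] \<in> X" by (auto simp: not_null_iff r)
      then have "[c, b] \<in> p_lang n"
        using append_in_shuffle_sets[OF _ bq, of "[c]" X] sh by simp
      then show False using p_sum_Cons p_sum_bb by blast
    qed
    then show ?thesis using sh by (simp add: r null_traces)
  qed
  show "traces p = {[], [a]}"
  proof -
    have "\<alpha> \<in> {[], [a]}" if "\<alpha> \<in> traces p" for \<alpha>
    proof (cases \<alpha>)
      case (Cons c \<beta>)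
      then have "c = a" using that p traces_append[of "[c]" \<beta> p] by simp
      then show ?thesis using Cons that a_der by (auto simp: Cons_in_traces_der)
    qed auto
    then show ?thesis using \<open>[a] \<in> traces p\<close> by auto
  qed
  show "traces q = p_lang n"
    using \<open>[a] \<in> traces p\<close> a_der by (auto simp: Cons_in_traces_der)
  show "\<forall>X \<in> der q b. \<forall>i j. branch i \<in> X \<longrightarrow> branch j \<in> X \<longrightarrow> i = j"
  proof (intro ballI allI impI)
    fix X i j assume X: "X \<in> der q b" "branch i \<in> X" "branch j \<in> X"
    then have "shuffle_sets (traces p) X \<in> der (p \<parallel> q) b"
      by (simp add: der_par)
    then have "shuffle_sets (traces p) X \<in> der (lhs n :: ('a, 'v) trm) b"
      using below unfolding below_def by blast
    then obtain k where k: "shuffle_sets (traces p) X = shuffle_sets {[], [a]} (set (prefixes (branch k)))"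
      by (auto simp: der_lhs)
    \<comment> \<open>The \<open>a\<close> of \<open>p\<close> is appended to obtain a word that
      determines its branch.\<close>
    have "branch l @ [a] \<in> shuffle_sets (traces p) X" if "branch l \<in> X" for l
      using append_in_shuffle_sets[OF that \<open>[a] \<in> traces p\<close>] by (simp add: shuffle_sets_commute)
    then show "i = j" using X lhs_branch_unique unfolding k by metis
  qed
qed

lemma below_mono:
  fixes p q :: "('a, 'v) trm"
  shows "below n p \<Longrightarrow> (\<And>c. der q c \<subseteq> der p c) \<Longrightarrow> below n q"
  unfolding below_def by blast

lemma below_par_commute: "below n (p \<parallel> q) \<longleftrightarrow> below n (q \<parallel> p)"
  by (simp add: below_def der_par_commute[of p])

text \<open>Serves the case of a parallel summand hidden in the value of a variable: below a prefix
  such a variable would yield a word outside \<open>p_lang n\<close>.\<close>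

lemma below_has_par_summand_trace:
  fixes p :: "('a, 'v) trm"
  assumes "below n p" "has_par_summand p" "n \<ge> 1"
  shows "a # b # branch 1 \<in> traces p"
proof -
  have *: "a # b # branch 1 \<in> traces (q1 \<parallel> q2)"
    if "below n (q1 \<parallel> q2)" "\<not> null q1" "\<not> null q2"
      "\<forall>c. [c] \<in> traces q1 \<longrightarrow> c = a" "\<forall>c. [c] \<in> traces q2 \<longrightarrow> c = b"
    for q1 q2 :: "('a, 'v) trm"
    using append_in_shuffle_sets[of "[a]" "traces q1" "b # branch 1" "traces q2"]
      below_par_left(1,2)[OF that] p_sum_branch[of 1 n] \<open>n \<ge> 1\<close>
    by (auto simp: traces_par)
  obtain q1 q2 :: "('a, 'v) trm" where q: "\<forall>c. der (q1 \<parallel> q2) c \<subseteq> der p c" "\<not> null q1" "\<not> null q2"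
    using assms(2) by (rule has_par_summandD)
  have below: "below n (q1 \<parallel> q2)" using below_mono[OF assms(1)] q(1) by blast
  from below q(2,3) have "a # b # branch 1 \<in> traces (q1 \<parallel> q2)"
  proof (cases rule: below_par_cases)
    case left
    show ?thesis by (rule *[OF below q(2,3) left])
  next
    case right
    have "below n (q2 \<parallel> q1)" using below below_par_commute by blast
    from *[OF this q(3,2) right(2,1)] show ?thesis
      by (simp add: traces_par shuffle_sets_commute)
  qed
  then show ?thesis using traces_mono_der[OF q(1)[rule_format]] by blast
qed

text \<open>A term with fewer than \<open>n\<close> subterms cannot supply the \<open>n\<close> different derivatives of
  \<open>p_sum n\<close> by its own prefixes.\<close>

lemma exposed_variable:
  assumes T: "traces (subst \<sigma> t) = p_lang n"
    and uniq: "\<forall>X \<in> der (subst \<sigma> t) b. \<forall>i j. branch i \<in> X \<longrightarrow> branch j \<in> X \<longrightarrow> i = j"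
    and small: "card (subterms t) < n"
  obtains x i where "head \<sigma> (Var x) t" "b # branch i \<in> traces (\<sigma> x)"
proof (rule ccontr)
  assume "\<not> thesis"
  with that have none: "\<not> (head \<sigma> (Var x) t \<and> b # branch i \<in> traces (\<sigma> x))" for x i
    by blast
  \<comment> \<open>\<open>?f\<close> gives the trace set below a prefix. The default
    \<open>{}\<close> is a filler, since only prefixes are looked up; at most
    \<open>card (subterms t)\<close> values arise.\<close>
  let ?f = "\<lambda>s. case s of c \<cdot> w \<Rightarrow> traces (subst \<sigma> w) | _ \<Rightarrow> {}"
  have "\<exists>X \<in> ?f ` subterms t. X \<in> der (subst \<sigma> t) b \<and> branch i \<in> X" if "i \<in> {1..n}" for i
  proof -
    have "b # branch i \<in> traces (subst \<sigma> t)" using T p_sum_branch that by blast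
    then obtain X where X: "X \<in> der (subst \<sigma> t) b" "branch i \<in> X"
      by (auto simp: Cons_in_traces_der)
    from X(1) have "X \<in> ?f ` subterms t"
    proof (cases rule: der_subst_cases)
      case (Var x)
      then show ?thesis using none[of x i] X(2) by (auto simp: Cons_in_traces_der)
    next
      case (Prefix w)
      then show ?thesis using head_subterms by force
    next
      \<comment> \<open>Two active factors can act in either order, which no pair of actions can do
        in \<open>p_lang n\<close>.\<close>
      case (Par t1 t2)
      then obtain c d where "[c] \<in> traces (subst \<sigma> t1)" "[d] \<in> traces (subst \<sigma> t2)"
        by (auto simp: not_null_iff)
      then have "[c] @ [d] \<in> traces (subst \<sigma> t1 \<parallel> subst \<sigma> t2)"
        "[d] @ [c] \<in> traces (subst \<sigma> t2 \<parallel> subst \<sigma> t1)"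
        unfolding traces_par by (auto intro!: append_in_shuffle_sets simp del: append.simps)
      moreover have "traces (subst \<sigma> (t1 \<parallel> t2)) \<subseteq> p_lang n"
        using traces_mono_der[of "subst \<sigma> (t1 \<parallel> t2)" "subst \<sigma> t"] head_der[OF Par(1)] T by blast
      ultimately have "[c, d] \<in> p_lang n" "[d, c] \<in> p_lang n"
        by (auto simp: traces_par shuffle_sets_commute)
      then show ?thesis using p_sum_Cons p_sum_bb by blast
    qed
    with X show ?thesis by blast
  qed
  then obtain g where g: "\<And>i. i \<in> {1..n} \<Longrightarrow>
      g i \<in> ?f ` subterms t \<and> g i \<in> der (subst \<sigma> t) b \<and> branch i \<in> g i"
    by metis
  have "inj_on g {1..n}"
    by (rule inj_onI) (metis g uniq)
  then have "n \<le> card (?f ` subterms t)"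
    using card_inj_on_le[of g "{1..n}" "?f ` subterms t"] g by fastforce
  also have "\<dots> \<le> card (subterms t)"
    by (rule card_image_le) simp
  finally show False using small by simp
qed

text \<open>Below \<open>p_sum n\<close>, a variable performing \<open>b # branch i\<close> cannot be guarded nor run in parallel
  with something active, so changing its value only changes that summand.\<close>

lemma traces_change_exposed:
  fixes \<sigma> \<tau> :: "'v \<Rightarrow> ('a, 'v) trm"
  assumes "traces (subst \<sigma> w) \<subseteq> p_lang n" "b # branch i \<in> traces (\<sigma> x)"
    and \<tau>: "\<And>y. y \<noteq> x \<Longrightarrow> \<tau> y = \<sigma> y" "\<not> null (\<tau> x)"
  shows "traces (subst \<tau> w) \<subseteq> traces (subst \<sigma> w) \<union> traces (\<tau> x)"
  using assms(1)
proof (induction w)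
  case (Var y)
  then show ?case using \<tau>(1) by (cases "y = x") auto
next
  case (Prefix c w)
  \<comment> \<open>A guarded \<open>x\<close> would perform \<open>b # branch i\<close> only after
    \<open>c\<close>, against \<open>p_sum_unshifted\<close>.\<close>
  have "x \<notin> vars w"
  proof
    assume "x \<in> vars w"
    then obtain \<alpha> where "\<alpha> @ b # branch i \<in> traces (subst \<sigma> w)"
      using traces_of_occurrence assms(2) by metis
    then have "(c # \<alpha>) @ b # branch i \<in> p_lang n" using Prefix.prems by auto
    then show False using p_sum_unshifted by blast
  qed
  then have "subst \<tau> w = subst \<sigma> w" by (intro subst_cong \<tau>(1)) auto
  then show ?case by simp
next
  case (Plus w1 w2)
  then show ?case by auto
next
  case (Par w1 w2)
  have nn: "null (\<sigma> y) \<longleftrightarrow> null (\<tau> y)" for y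
    using assms(2) \<tau> by (cases "y = x") (auto simp: null_traces)
  note null_eq = null_subst_cong[of \<sigma> \<tau>, OF nn]
  \<comment> \<open>An active neighbour could act before the \<open>b # branch i\<close> of
    \<open>x\<close>.\<close>
  have *: "null v'" if v: "x \<in> vars v"
    "shuffle_sets (traces (subst \<sigma> v)) (traces v') \<subseteq> p_lang n" for v v' :: "('a, 'v) trm"
  proof (rule ccontr)
    assume "\<not> null v'"
    then obtain c where c: "[c] \<in> traces v'" by (auto simp: not_null_iff)
    obtain \<alpha> where \<alpha>: "\<alpha> @ b # branch i \<in> traces (subst \<sigma> v)"
      using traces_of_occurrence v(1) assms(2) by metis
    then have "(c # \<alpha>) @ b # branch i \<in> p_lang n"
      using append_in_shuffle_sets[OF c \<alpha>] v(2)
      by (auto simp: shuffle_sets_commute[of "traces v'"])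
    then show False using p_sum_unshifted by blast
  qed
  have sh: "shuffle_sets (traces (subst \<sigma> w1)) (traces (subst \<sigma> w2)) \<subseteq> p_lang n"
    using Par.prems by (simp add: traces_par)
  consider "x \<in> vars w1" | "x \<in> vars w2" | "x \<notin> vars (w1 \<parallel> w2)" by auto
  then show ?case
  proof cases
    case 1
    then have "null (subst \<sigma> w2)" using * sh by blast
    then show ?thesis using Par null_eq[of w2] by (auto simp: traces_par null_traces)
  next
    case 2
    then have "null (subst \<sigma> w1)" using * sh shuffle_sets_commute by metis
    then show ?thesis using Par null_eq[of w1] by (auto simp: traces_par null_traces)
  next
    case 3
    then have "subst \<tau> (w1 \<parallel> w2) = subst \<sigma> (w1 \<parallel> w2)"
      by (intro subst_cong \<tau>(1)) auto
    then show ?thesis by auto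
  qed
qed auto

section \<open>Small sound equations preserve active parallel summands\<close>

text \<open>The change of value is applied to a variable exposed in \<open>t\<close>, whence the
  size bound on \<open>t\<close>. Exchanging the two sides gives the converse implication for an
  axiom.\<close>

lemma axiom_preserves_par_summand:
  fixes t u :: "('a, 'v) trm"
  assumes sound: "\<forall>\<tau> c. (\<forall>y. \<tau> y \<in> processes) \<longrightarrow> der (subst \<tau> t) c = der (subst \<tau> u) c"
    and closed: "\<forall>y. \<sigma> y \<in> processes"
    and small: "card (subterms t) < n"
    and below: "below n (subst \<sigma> t)"
    and par: "has_par_summand (subst \<sigma> t)"
  shows "has_par_summand (subst \<sigma> u)"
proof (rule ccontr)
  assume no_par: "\<not> has_par_summand (subst \<sigma> u)"
  \<comment> \<open>The first \<open>a\<close> creates a new \<open>a\<close>-derivative, and the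
    remaining \<open>b b\<close> lies outside \<open>p_lang n\<close>, the trace set of every
    \<open>a\<close>-derivative under \<open>\<sigma>\<close>.\<close>
  define q :: "('a, 'v) trm" where "q = a \<cdot> word [b, b]"
  have [simp]: "\<not> null q" "vars q = {}" by (simp_all add: q_def)
  define L where "L = set (prefixes [b, b])"
  have L: "[b, b] \<in> L" "[b, b, a] \<notin> L" by (auto simp: L_def)
  have q_der: "der q a = {L}"
    by (simp add: q_def L_def del: word.simps prefixes.simps)
  have "q = word [a, b, b]" by (simp add: q_def)
  then have q_traces: "traces q = set (prefixes [a, b, b])" by (simp only: traces_word)
  have "n \<ge> 1" using small by simp
  have below_u: "below n (subst \<sigma> u)"
    using below sound closed by (simp add: below_def)
  have q_closed: "(\<sigma>(x := q)) y \<in> processes" for x y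
    using closed by (simp add: processes_def)

  \<comment> \<open>Only the variable itself or a prefix guarding it can account for a derivative
    of \<open>u\<close> created by changing the value of a variable.\<close>
  have change: "head \<sigma> (Var x) u \<and> Y = L \<or>
      (\<exists>w. x \<in> vars w \<and> traces (subst \<sigma> w) = p_lang n \<and> Y = traces (subst (\<sigma>(x := q)) w))"
    if "\<not> null (\<sigma> x)" "Y \<in> der (subst (\<sigma>(x := q)) t) a" "Y \<noteq> p_lang n" for x Y
  proof -
    have nn: "null ((\<sigma>(x := q)) y) \<longleftrightarrow> null (\<sigma> y)" for y
      using that(1) by auto
    note head_eq = head_cong[of "\<sigma>(x := q)" _ _ \<sigma>, OF _ nn]
    have from_\<sigma>: "Z = p_lang n" if "head \<sigma> s u" "Z \<in> der (subst \<sigma> s) a" for s Z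
      using head_der[OF that(1)] that(2) below_u der_lhs(1) by (fastforce simp: below_def)
    have "Y \<in> der (subst (\<sigma>(x := q)) u) a"
      using that(2) sound q_closed by blast
    then show ?thesis
    proof (cases rule: der_subst_cases)
      case (Var y)
      then have "head \<sigma> (Var y) u" using head_eq by blast
      then show ?thesis
        using Var(2) from_\<sigma>[of "Var y" Y] that(3) by (cases "y = x") (auto simp: q_der)
    next
      case (Prefix w)
      then have "head \<sigma> (a \<cdot> w) u" using head_eq by blast
      then have T: "traces (subst \<sigma> w) = p_lang n" using from_\<sigma>[of "a \<cdot> w"] by simp
      have "x \<in> vars w"
      proof (rule ccontr)
        assume "x \<notin> vars w"
        then have "subst (\<sigma>(x := q)) w = subst \<sigma> w" by (intro subst_cong) auto
        then show False using T Prefix(2) that(3) by simp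
      qed
      then show ?thesis using T Prefix(2) by blast
    next
      case (Par t1 t2)
      then have "head \<sigma> (t1 \<parallel> t2) u" using head_eq by blast
      \<comment> \<open>The same factors are active under both substitutions, so this parallel
        summand would already be present under \<open>\<sigma>\<close>.\<close>
      moreover have "has_par_summand (subst \<sigma> (t1 \<parallel> t2))"
        using Par null_subst_cong[of "\<sigma>(x := q)" \<sigma>, OF nn] by simp
      ultimately show ?thesis using head_has_par_summand no_par by blast
    qed
  qed

  from par show False
  proof (cases rule: has_par_summand_cases)
    case (Var x)
    have "below n (\<sigma> x)"
      using below_mono[OF below] head_der[OF Var(1)] by simp
    then have tr: "a # b # branch 1 \<in> traces (\<sigma> x)"
      using below_has_par_summand_trace Var(2) \<open>n \<ge> 1\<close> by blast
    then have nn: "\<not> null (\<sigma> x)" by (auto simp: null_traces)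
    have "head (\<sigma>(x := q)) (Var x) t"
      using head_cong[OF Var(1), of "\<sigma>(x := q)"] nn by simp
    then have "L \<in> der (subst (\<sigma>(x := q)) t) a"
      using head_der[of "\<sigma>(x := q)" "Var x" t a] by (auto simp: q_der)
    moreover have "L \<noteq> p_lang n" using L p_sum_bb by metis
    ultimately consider "head \<sigma> (Var x) u"
      | w where "x \<in> vars w" "traces (subst \<sigma> w) = p_lang n"
      using change[OF nn] by metis
    then show False
    proof cases
      case 1
      then show False using head_has_par_summand[of \<sigma> "Var x" u] Var(2) no_par by simp
    next
      case 2
      \<comment> \<open>The leading \<open>a\<close> of the trace is counted as context, so that
        \<open>b # branch 1\<close> appears shifted.\<close>
      then obtain \<alpha> where "(\<alpha> @ [a]) @ b # branch 1 \<in> p_lang n"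
        using traces_of_occurrence[OF 2(1), where \<sigma> = \<sigma>, OF tr] by auto
      then show False using p_sum_unshifted by blast
    qed
  next
    case (Par t1 t2)
    have below_par: "below n (subst \<sigma> t1 \<parallel> subst \<sigma> t2)"
      using below_mono[OF below] head_der[OF Par(1)] by simp
    \<comment> \<open>Here \<open>t'\<close> plays the role of \<open>a\<close> and
      \<open>t''\<close> that of \<open>p\<^sub>n\<close>; stated for arbitrary terms to cover both
      orders of \<open>t1\<close> and \<open>t2\<close>.\<close>
    have main: False
      if sub: "subterms t'' \<subseteq> subterms t"
        and below': "below n (subst \<sigma> t' \<parallel> subst \<sigma> t'')"
        and der: "\<forall>\<tau> c. (\<forall>y. null (\<sigma> y) \<longleftrightarrow> null (\<tau> y)) \<longrightarrow>
          der (subst \<tau> t' \<parallel> subst \<tau> t'') c \<subseteq> der (subst \<tau> t) c"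
        and nn': "\<not> null (subst \<sigma> t')" "\<not> null (subst \<sigma> t'')"
        and I: "\<forall>c. [c] \<in> traces (subst \<sigma> t') \<longrightarrow> c = a" "\<forall>c. [c] \<in> traces (subst \<sigma> t'') \<longrightarrow> c = b"
      for t' t'' :: "('a, 'v) trm"
    proof -
      note T = below_par_left[OF below' nn' I]
      have "card (subterms t'') < n"
        using small card_mono[OF finite_subterms sub] by simp
      then obtain x i where x: "head \<sigma> (Var x) t''" "b # branch i \<in> traces (\<sigma> x)"
        using exposed_variable[OF T(2,3)] by blast
      have nn: "\<not> null (\<sigma> x)" using x(2) by (auto simp: null_traces)
      let ?\<tau> = "\<sigma>(x := q)"
      have null_eq: "null (\<sigma> y) \<longleftrightarrow> null (?\<tau> y)" for y using nn by simp
      have "x \<notin> vars t'"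
      proof
        assume "x \<in> vars t'"
        then obtain \<alpha> where "\<alpha> @ b # branch i \<in> traces (subst \<sigma> t')"
          using traces_of_occurrence x(2) by metis
        then show False using T(1) ab by (auto simp: Cons_eq_append_conv append_eq_Cons_conv branch_def)
      qed
      then have "subst ?\<tau> t' = subst \<sigma> t'" by (intro subst_cong) auto
      then have t': "traces (subst ?\<tau> t') = {[], [a]}" using T(1) by simp
      let ?Y = "shuffle_sets {[], [a]} L"
      have "head ?\<tau> (Var x) t''" using head_cong[OF x(1), of ?\<tau>] null_eq by blast
      then have "L \<in> der (subst ?\<tau> t'') a"
        using head_der[of ?\<tau> "Var x" t'' a] by (auto simp: q_der)
      then have "?Y \<in> der (subst ?\<tau> t' \<parallel> subst ?\<tau> t'') a"
        by (simp add: der_par t')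
      then have Y: "?Y \<in> der (subst ?\<tau> t) a"
        using der null_eq by blast
      \<comment> \<open>This word separates \<open>?Y\<close> from every possible match: it is not
        in \<open>L\<close>, it starts with \<open>b b\<close> unlike words of
        \<open>p_lang n\<close>, and it does not start with \<open>a\<close> like the nonempty
        traces of \<open>q\<close>.\<close>
      have bba: "[b, b, a] \<in> ?Y"
        using append_in_shuffle_sets[OF L(1), of "[a]" "{[], [a]}"]
        by (simp add: shuffle_sets_commute[of L])
      then have "?Y \<noteq> p_lang n" using p_sum_bb by metis
      from change[OF nn Y this] show False
      proof (elim disjE conjE exE)
        assume "?Y = L"
        with bba L show False by simp
      next
        fix w assume w: "traces (subst \<sigma> w) = p_lang n" "?Y = traces (subst ?\<tau> w)"
        then have "?Y \<subseteq> p_lang n \<union> traces q"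
          using traces_change_exposed[of \<sigma> w n i x ?\<tau>] x(2) by simp
        then show False using bba p_sum_bb ab by (auto simp: q_traces)
      qed
    qed
    have sub: "subterms t1 \<subseteq> subterms t" "subterms t2 \<subseteq> subterms t"
      using subterms_trans[OF head_subterms[OF Par(1)]] by auto
    have der: "\<forall>\<tau> c. (\<forall>y. null (\<sigma> y) \<longleftrightarrow> null (\<tau> y)) \<longrightarrow>
        der (subst \<tau> t1 \<parallel> subst \<tau> t2) c \<subseteq> der (subst \<tau> t) c"
    proof (intro allI impI)
      fix \<tau> :: "'v \<Rightarrow> ('a, 'v) trm" and c
      assume "\<forall>y. null (\<sigma> y) \<longleftrightarrow> null (\<tau> y)"
      then have "head \<tau> (t1 \<parallel> t2) t" using head_cong[OF Par(1)] by blast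
      then show "der (subst \<tau> t1 \<parallel> subst \<tau> t2) c \<subseteq> der (subst \<tau> t) c"
        using head_der[of \<tau> "t1 \<parallel> t2" t c] by simp
    qed
    from below_par Par(2,3) show False
    proof (cases rule: below_par_cases)
      case left
      show False by (rule main[OF sub(2) below_par der Par(2,3) left])
    next
      case right
      have "below n (subst \<sigma> t2 \<parallel> subst \<sigma> t1)"
        using below_par below_par_commute by blast
      moreover have "\<forall>\<tau> c. (\<forall>y. null (\<sigma> y) \<longleftrightarrow> null (\<tau> y)) \<longrightarrow>
          der (subst \<tau> t2 \<parallel> subst \<tau> t1) c \<subseteq> der (subst \<tau> t) c"
        using der by (simp add: der_par_commute[of "subst _ t2"])
      ultimately show False by (rule main[OF sub(1) _ _ Par(3,2) right(2,1)])
    qed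
  qed
qed

section \<open>Derivations and the contradiction\<close>

text \<open>Membership in \<open>R\<close> is proved alongside, because it carries
  \<open>below\<close> across symmetry and transitivity, and inertness across parallel contexts. The
  closed \<open>\<rho>\<close> takes care of open terms inside derivations.\<close>

lemma derivable_preserves_par_summand:
  fixes R :: "('a, 'v) trm rel"
  assumes "E \<turnstile> t \<approx> u"
    and R: "congruence R" "R \<subseteq> pf_equivalence" and sound: "sound_modulo R E"
    and small: "\<And>t u. (t, u) \<in> E \<Longrightarrow> card (subterms t) < n \<and> card (subterms u) < n"
    and closed: "\<And>x. \<rho> x \<in> processes"
  shows "(subst \<rho> t, subst \<rho> u) \<in> R \<and>
    (below n (subst \<rho> t) \<longrightarrow> (has_par_summand (subst \<rho> t) \<longleftrightarrow> has_par_summand (subst \<rho> u)))"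
proof -
  have der_eq: "der p c = der q c" if "(p, q) \<in> R" for p q c
    using that R(2) by (auto simp: pf_equivalence_def possible_futures_der)
  have below_eq: "below n p \<longleftrightarrow> below n q" if "(p, q) \<in> R" for p q
    using der_eq[OF that] by (simp add: below_def)
  have null_eq: "null p \<longleftrightarrow> null q" if "(p, q) \<in> R" for p q
  proof -
    have "traces p = traces q"
      using der_eq[OF that] traces_mono_der[of p q] traces_mono_der[of q p] by blast
    then show ?thesis by (simp add: null_traces)
  qed
  have equiv: "equiv processes R" using R(1) by (simp add: congruence_def)
  show ?thesis using assms(1)
  proof (induction rule: derivable.induct)
    case (refl t)
    then show ?case using equiv closed_subst[OF closed] by (auto simp: equiv_def refl_on_def)
  next
    case (sym t u)
    then show ?case using equiv below_eq by (auto simp: equiv_def dest: symD)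
  next
    case (trans t u v)
    then show ?case using equiv below_eq unfolding equiv_def by (metis transD)
  next
    case (axiom_inst t u \<sigma>)
    let ?\<tau> = "\<lambda>x. subst \<rho> (\<sigma> x)"
    have tau: "\<forall>x. ?\<tau> x \<in> processes" by (intro allI closed_subst closed)
    have in_R: "(subst \<tau> t, subst \<tau> u) \<in> R" if "\<forall>x. \<tau> x \<in> processes" for \<tau>
      using sound axiom_inst that unfolding sound_modulo_def by blast
    then have eq: "\<forall>\<tau> c. (\<forall>x. \<tau> x \<in> processes) \<longrightarrow> der (subst \<tau> t) c = der (subst \<tau> u) c"
      using der_eq by blast
    then have eq': "\<forall>\<tau> c. (\<forall>x. \<tau> x \<in> processes) \<longrightarrow> der (subst \<tau> u) c = der (subst \<tau> t) c"
      by simp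
    have "has_par_summand (subst ?\<tau> t) \<longleftrightarrow> has_par_summand (subst ?\<tau> u)"
      if "below n (subst ?\<tau> t)"
    proof
      show "has_par_summand (subst ?\<tau> u)" if "has_par_summand (subst ?\<tau> t)"
        using axiom_preserves_par_summand[OF eq tau] small[OF axiom_inst]
          \<open>below n (subst ?\<tau> t)\<close> that by blast
      have "below n (subst ?\<tau> u)"
        using that below_eq[OF in_R[OF tau]] by blast
      then show "has_par_summand (subst ?\<tau> t)" if "has_par_summand (subst ?\<tau> u)"
        using axiom_preserves_par_summand[OF eq' tau] small[OF axiom_inst] that by blast
    qed
    then show ?case using in_R[OF tau] by (simp add: subst_subst)
  next
    case (prefix t u c)
    then show ?case using R(1) by (simp add: congruence_def)
  next
    case (plus t u t' u')
    then have "(subst \<rho> (t \<oplus> t'), subst \<rho> (u \<oplus> u')) \<in> R"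
      using R(1) by (simp add: congruence_def)
    then show ?case using plus.IH by (auto simp: below_def)
  next
    case (par t u t' u')
    have "(subst \<rho> (t \<parallel> t'), subst \<rho> (u \<parallel> u')) \<in> R"
      using par R(1) by (simp add: congruence_def)
    \<comment> \<open>With both factors active, both sides have a parallel summand. If one factor is
      inert, the derivatives are those of the other, to which the induction hypothesis
      applies.\<close>
    moreover have "null (subst \<rho> t) \<longleftrightarrow> null (subst \<rho> u)" "null (subst \<rho> t') \<longleftrightarrow> null (subst \<rho> u')"
      using par null_eq by blast+
    ultimately show ?case using par.IH by (auto simp: below_def)
  qed
qed

lemma no_finite_axiomatisation:
  fixes R :: "('a, 'v) trm rel"
  assumes R: "congruence R" "bisimilarity \<subseteq> R" "R \<subseteq> pf_equivalence"
    and E: "finite E" "sound_modulo R E" "ground_complete R E"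
  shows False
proof -
  let ?S = "\<Union>(t, u) \<in> E. subterms t \<union> subterms u"
  \<comment> \<open>The successor makes \<open>n\<close> exceed the number of subterms of every side
    of every axiom, and also positive.\<close>
  define n where "n = Suc (card ?S)"
  have fin: "finite ?S" using E(1) by auto
  have small: "card (subterms t) < n \<and> card (subterms u) < n" if "(t, u) \<in> E" for t u
  proof -
    have "subterms t \<subseteq> ?S" "subterms u \<subseteq> ?S" using that by blast+
    then show ?thesis using card_mono[OF fin] unfolding n_def by (simp add: less_Suc_eq_le)
  qed
  let ?l = "lhs n :: ('a, 'v) trm" and ?r = "rhs n :: ('a, 'v) trm"
  have "E \<turnstile> ?l \<approx> ?r"
    using E(3) R(2) lhs_rhs_bisimilar lhs_processes rhs_processes
    unfolding ground_complete_def by blast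
  \<comment> \<open>Any closed substitution would do here, since both processes are closed and
    remain unchanged.\<close>
  then have "below n (subst (\<lambda>_. \<zero>) ?l) \<longrightarrow>
      (has_par_summand (subst (\<lambda>_. \<zero>) ?l) \<longleftrightarrow> has_par_summand (subst (\<lambda>_. \<zero>) ?r))"
    using derivable_preserves_par_summand[OF _ R(1,3) E(2) small, of _ _ "\<lambda>_. \<zero>"]
    by (simp add: processes_def)
  then have "below n ?l \<longrightarrow> (has_par_summand ?l \<longleftrightarrow> has_par_summand ?r)"
    by (simp only: subst_closed[OF lhs_processes] subst_closed[OF rhs_processes])
  moreover have "below n ?l" by (simp add: below_def)
  moreover have "n \<ge> 1" by (simp add: n_def)
  ultimately show False
    using lhs_has_par_summand rhs_not_has_par_summand by blast
qed

end

theorem theorem6p13: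
  fixes R :: "('a::finite, 'v) trm rel"
  assumes "card (UNIV :: 'a set) \<ge> 2"
    and "countable (UNIV :: 'v set)" and "infinite (UNIV :: 'v set)"
    and "congruence R"
    and "bisimilarity \<subseteq> R" and "R \<subseteq> pf_equivalence"
  shows "\<not> (\<exists>E :: ('a, 'v) trm rel. finite E \<and> sound_modulo R E \<and> ground_complete R E)"
proof -
  obtain a b :: 'a where "a \<noteq> b"
    using assms(1) card_le_Suc0_iff_eq[of "UNIV :: 'a set"] by force
  from no_finite_axiomatisation[OF this assms(4-6)] show ?thesis
    by (intro notI) (elim exE conjE)
qed

end
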